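(* Let $\lambda=\{k_1,k_2,\ldots,k_q\}$ be a finite multiset of positive integers with $|\lambda|<k_{\lambda}$. If $k_i\le 2$ for each $i$, then $\psi(\lambda)=2k_{\lambda}+1_{\lambda}+2$.
   Context: All graphs are finite and simple. For a finite multiset $\lambda=\{k_1,\ldots,k_q\}$ of positive integers, $|\lambda|=q$ is the number of elements counted with multiplicity, $k_{\lambda}=\sum_{i=1}^q k_i$, and $1_{\lambda}$ is the multiplicity of $1$ in $\lambda$. A graph is $k$-chromatic if its chromatic number equals $k$. The $k$-painting game on a graph $G$ is played by Lister and Painter. Initially every vertex has $k$ tokens and is uncoloured. In each round Lister chooses a nonempty set $U$ of uncoloured vertices and takes away one token from each $v\in U$ (the vertices of $U$ are said to be selected in this round); then Painter colours the vertices of an independent set $I$ of $G$ contained in $U$. If at the end of some round there is an uncoloured vertex with no tokens left, Lister wins; otherwise all vertices are eventually coloured and Painter wins. For an enumeration $k_1,\ldots,k_q$ of $\lambda$, the $\lambda$-painting game on $G$ is the $k_{\lambda}$-painting game in which Lister must play so that the following holds: there are integers $k'_1,\ldots,k'_q\ge 0$ (depending on the play, not fixed in advance) such that in the first $k'_1$ rounds each vertex is selected in $k_1$ rounds, in the next $k'_2$ rounds each vertex is selected in $k_2$ rounds, and so on; here a vertex ceases to be selectable once it is coloured, so the requirement is that for each $i$ every vertex is selected at most $k_i$ times in the $i$-th block of rounds, and every vertex still uncoloured at the end of the $i$-th block has been selected exactly $k_i$ times in that block. $G$ is $\lambda$-paintable if Painter has a winning strategy in the $\lambda$-painting game on $G$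 (for every enumeration of $\lambda$). $\psi(\lambda)$ is the least integer $n$ such that there exists a non-$\lambda$-paintable $k_{\lambda}$-chromatic graph with $n$ vertices ($\psi(\lambda)=\infty$ if no such graph exists). *)

theory Defs
  imports "HOL-Library.Multiset" "HOL-Library.Extended_Nat"
begin

definition simple_graph :: "'a set \<Rightarrow> 'a set set \<Rightarrow> bool" where
  "simple_graph V E \<longleftrightarrow> finite V \<and> (\<forall>e\<in>E. e \<subseteq> V \<and> card e = 2)"

definition independent_set :: "'a set set \<Rightarrow> 'a set \<Rightarrow> bool" where
  "independent_set E I \<longleftrightarrow> (\<forall>u\<in>I. \<forall>v\<in>I. {u, v} \<notin> E)"

definition proper_colouring :: "'a set \<Rightarrow> 'a set set \<Rightarrow> nat \<Rightarrow> ('a \<Rightarrow> nat) \<Rightarrow> bool" where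
  "proper_colouring V E k c \<longleftrightarrow>
     (\<forall>v\<in>V. c v < k) \<and> (\<forall>u\<in>V. \<forall>v\<in>V. {u, v} \<in> E \<longrightarrow> c u \<noteq> c v)"

definition chromatic_number :: "'a set \<Rightarrow> 'a set set \<Rightarrow> nat" where
  "chromatic_number V E = (LEAST k. \<exists>c. proper_colouring V E k c)"

text \<open>
  A round is a pair of the set selected by Lister and the set coloured by Painter;
  a history is the list of the rounds played so far, oldest first.
\<close>

type_synonym 'a round = "'a set \<times> 'a set"

definition coloured :: "'a round list \<Rightarrow> 'a set" where
  "coloured h = (\<Union>r\<in>set h. snd r)"

definition selections :: "'a round list \<Rightarrow> 'a \<Rightarrow> nat" where
  "selections h v = length (filter (\<lambda>r. v \<in> fst r) h)"

definition tokens :: "nat \<Rightarrow> 'a round list \<Rightarrow> 'a \<Rightarrow> nat" where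
  "tokens k h v = k - selections h v"

text \<open>
  A play is not cut off when Lister has won: the remaining vertices that still have tokens may be
  selected further. This does not affect the outcome, because an uncoloured vertex without tokens
  can never be selected, hence never be coloured, again. It allows the block condition below to be
  imposed on the play as a whole.
\<close>

definition painting_play :: "'a set \<Rightarrow> 'a set set \<Rightarrow> nat \<Rightarrow> 'a round list \<Rightarrow> bool" where
  "painting_play V E k h \<longleftrightarrow>
     (\<forall>n<length h. case h ! n of (U, I) \<Rightarrow>
        U \<noteq> {} \<and> U \<subseteq> V - coloured (take n h) \<and> (\<forall>v\<in>U. tokens k (take n h) v > 0) \<and>
        I \<subseteq> U \<and> independent_set E I)"

definition lister_wins :: "'a set \<Rightarrow> nat \<Rightarrow> 'a round list \<Rightarrow> bool" where
  "lister_wins V k h \<longleftrightarrow>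
     (\<exists>n\<in>{1..length h}. \<exists>v \<in> V - coloured (take n h). tokens k (take n h) v = 0)"

text \<open>
  A strategy for Painter maps the rounds played so far and the set just selected by Lister to the
  set to be coloured.
\<close>

definition painter_strategy ::
    "'a set set \<Rightarrow> ('a round list \<Rightarrow> 'a set \<Rightarrow> 'a set) \<Rightarrow> bool" where
  "painter_strategy E \<sigma> \<longleftrightarrow> (\<forall>h U. \<sigma> h U \<subseteq> U \<and> independent_set E (\<sigma> h U))"

definition follows_strategy ::
    "('a round list \<Rightarrow> 'a set \<Rightarrow> 'a set) \<Rightarrow> 'a round list \<Rightarrow> bool" where
  "follows_strategy \<sigma> h \<longleftrightarrow> (\<forall>n<length h. snd (h ! n) = \<sigma> (take n h) (fst (h ! n)))"

text \<open>
  The play \<open>h\<close> splits into consecutive blocks \<open>bs\<close>, the \<open>i\<close>-th one consisting of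
  \<open>length (bs ! i)\<close> rounds, possibly none; the lengths are not fixed in advance. Every position in
  which no block bound has been exceeded can be continued, against any replies of Painter, to a
  play satisfying this condition, e.g. by selecting single vertices. So the condition forbids Lister
  only those selections that exceed a block bound or start a new block too early.
\<close>

definition respects_blocks :: "'a set \<Rightarrow> nat list \<Rightarrow> 'a round list \<Rightarrow> bool" where
  "respects_blocks V ks h \<longleftrightarrow>
     (\<exists>bs. concat bs = h \<and> length bs = length ks \<and>
        (\<forall>i<length ks. \<forall>v\<in>V.
           selections (bs ! i) v \<le> ks ! i \<and>
           (v \<notin> coloured (concat (take (Suc i) bs)) \<longrightarrow> selections (bs ! i) v = ks ! i)))"

definition painter_wins_block_game :: "'a set \<Rightarrow> 'a set set \<Rightarrow> nat list \<Rightarrow> bool" where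
  "painter_wins_block_game V E ks \<longleftrightarrow>
     (\<exists>\<sigma>. painter_strategy E \<sigma> \<and>
        (\<forall>h. painting_play V E (sum_list ks) h \<and> respects_blocks V ks h \<and> follows_strategy \<sigma> h
             \<longrightarrow> \<not> lister_wins V (sum_list ks) h))"

definition paintable :: "'a set \<Rightarrow> 'a set set \<Rightarrow> nat multiset \<Rightarrow> bool" where
  "paintable V E L \<longleftrightarrow> (\<forall>ks. mset ks = L \<longrightarrow> painter_wins_block_game V E ks)"

text \<open>
  Every finite graph is isomorphic to one on a set of natural numbers, so it suffices to range over
  the latter. The infimum of a nonempty set in \<^typ>\<open>enat\<close> is its least element, and
  the infimum of the empty set is \<open>\<infinity>\<close>.
\<close>

definition psi :: "nat multiset \<Rightarrow> enat" where
  "psi L = Inf {enat (card V) | (V :: nat set) E.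
     simple_graph V E \<and> chromatic_number V E = sum_mset L \<and> \<not> paintable V E L}"

end

theory Submission
  imports Defs "HOL-Library.Disjoint_Sets"
begin

text \<open>
  Write \<open>a\<close> and \<open>b\<close> for the multiplicities of 1 and 2, so that \<open>k = a + 2 * b\<close>.

  Lower bound: let a \<open>k\<close>-chromatic graph have at most \<open>3 * a + 4 * b + 1\<close> vertices, and take the \<open>k\<close>
  classes of a proper colouring. Painter gives one class to each block 1 and two classes to each
  block 2, and colours in a block only vertices of its classes. Two classes can be coloured in a
  block 2 if one of them is a singleton or if their sizes are at most 2 and 3. A suitable
  distribution is found greedily: a block 1 receives a largest class; a block 2 receives a class of
  size at least 3 with a singleton, or two classes of size 2, or, when neither is available, classes
  of sizes 2 and 3, and the vertex count excludes all other cases.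

  Upper bound: take the complete multipartite graph with \<open>a + b + 1\<close> parts of size 3 and \<open>b - 1\<close>
  parts of size 1. Lister selects everything in the only round of a block 1. In a block 2 he plays
  three rounds, each leaving out one vertex of every part of size 3. Colouring a part of size 3 thus
  takes one round of a block 1 or two rounds of blocks 2. If rounds of blocks 1 count twice, Painter
  needs \<open>2 * (a + b + 1) + (b - 1) = 2 * a + 3 * b + 1\<close> units but has only \<open>2 * a + 3 * b\<close>.
\<close>

subsection \<open>Two colour classes in one block\<close>

text \<open>\<open>A\<close> and \<open>B\<close> are the uncoloured vertices of the two classes, all with one or two selections left
  in the block, and \<open>D\<close> is the set of those with exactly one left.\<close>

definition winning :: "'a set \<Rightarrow> 'a set \<Rightarrow> 'a set \<Rightarrow> bool" where
  "winning A B D \<longleftrightarrow> A = {} \<or> B = {} \<or> ((card A \<le> 1 \<or> card B \<le> 1) \<and> card D \<le> 1) \<or>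
     (card A \<le> 2 \<and> card B \<le> 3 \<and> D = {}) \<or> (card A \<le> 3 \<and> card B \<le> 2 \<and> D = {})"

lemma winning_commute: "winning A B D \<longleftrightarrow> winning B A D"
  unfolding winning_def by auto

text \<open>Some vertices of the classes may already be coloured, and the actual set of vertices
  with one selection left may be smaller than estimated; both only help Painter.\<close>

lemma winning_mono:
  assumes "winning A B D" "finite A" "finite B" "finite D" "A' \<subseteq> A" "B' \<subseteq> B" "D' \<subseteq> D"
  shows "winning A' B' D'"
proof -
  have c: "card A' \<le> card A" "card B' \<le> card B" "card D' \<le> card D"
    using assms by (auto intro: card_mono)
  consider "A = {} \<or> B = {}" | "card A \<le> 1" "card D \<le> 1" | "card B \<le> 1" "card D \<le> 1"
    | "card A \<le> 2" "card B \<le> 3" "D = {}" | "card A \<le> 3" "card B \<le> 2" "D = {}"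
    using assms(1) unfolding winning_def by blast
  then show ?thesis
  proof cases
    case 1 then show ?thesis using assms(5,6) unfolding winning_def by blast
  next
    case 2 then have "card A' \<le> 1" "card D' \<le> 1" using c by linarith+
    then show ?thesis unfolding winning_def by blast
  next
    case 3 then have "card B' \<le> 1" "card D' \<le> 1" using c by linarith+
    then show ?thesis unfolding winning_def by blast
  next
    case 4 then have "card A' \<le> 2" "card B' \<le> 3" using c by linarith+
    then show ?thesis using 4 assms(7) unfolding winning_def by blast
  next
    case 5 then have "card A' \<le> 3" "card B' \<le> 2" using c by linarith+
    then show ?thesis using 5 assms(7) unfolding winning_def by blast
  qed
qed

text \<open>Painter colours all selected vertices of one class. A selected vertex that is passed
  over must have had two selections left; it now has one left and joins \<open>D\<close>.\<close>

definition reply :: "'a set \<Rightarrow> 'a set \<Rightarrow> 'a set \<Rightarrow> 'a set \<Rightarrow> 'a set \<Rightarrow> bool" where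
  "reply A B D U C \<longleftrightarrow> (C = U \<inter> A \<or> C = U \<inter> B) \<and> (U - C) \<inter> (A \<union> B) \<inter> D = {} \<and>
     winning (A - C) (B - C) (D - C \<union> (U - C) \<inter> (A \<union> B))"

lemma reply_commute: "reply A B D U C \<longleftrightarrow> reply B A D U C"
  by (simp add: reply_def winning_commute Un_commute disj_commute)

text \<open>Colouring the only vertex \<open>x\<close> of \<open>A\<close> when it is selected
  leaves a single class. This is postponed only if the vertex of \<open>D\<close> lies in
  \<open>B\<close> and is selected too: then the selected part of \<open>B\<close> is coloured and
  \<open>x\<close> becomes the only vertex with one selection left.\<close>

lemma reply_star:
  assumes "finite B" "A \<inter> B = {}" "D \<subseteq> A \<union> B" "card A = 1" "card D \<le> 1"
  shows "\<exists>C. reply A B D U C"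
proof -
  obtain x where A: "A = {x}"
    using assms by (meson card_1_singletonE)
  have xB: "x \<notin> B" using assms A by auto
  have "finite D" using assms A finite_subset by fastforce
  then have D: "u = v" if "u \<in> D" "v \<in> D" for u v
    using assms(5) that card_le_Suc0_iff_eq by fastforce
  consider "x \<notin> U" | "x \<in> U" "U \<inter> B \<inter> D \<noteq> {}" | "x \<in> U" "U \<inter> B \<inter> D = {}"
    by blast
  then show ?thesis
  proof cases
    case 1
    have "D - U \<inter> B \<union> (U - U \<inter> B) \<inter> (A \<union> B) \<subseteq> D" using 1 A by auto
    then have "card (D - U \<inter> B \<union> (U - U \<inter> B) \<inter> (A \<union> B)) \<le> 1"
      using card_mono[OF \<open>finite D\<close>] assms(5) le_trans by blast
    moreover have "(U - U \<inter> B) \<inter> (A \<union> B) \<inter> D = {}" using 1 A by auto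
    moreover have "A - U \<inter> B = A" using A xB by auto
    ultimately have "reply A B D U (U \<inter> B)"
      unfolding reply_def winning_def using assms(4) by simp
    then show ?thesis by blast
  next
    case 2
    then have "x \<notin> D" using D xB by blast
    moreover have "D - U \<inter> B \<union> (U - U \<inter> B) \<inter> (A \<union> B) = {x}" using 2 D A xB by blast
    moreover have "(U - U \<inter> B) \<inter> (A \<union> B) \<inter> D = {}" using 2 A xB D by blast
    moreover have "A - U \<inter> B = A" using A xB by auto
    ultimately have "reply A B D U (U \<inter> B)"
      unfolding reply_def winning_def using assms(4) by simp
    then show ?thesis by blast
  next
    case 3
    then have "reply A B D U (U \<inter> A)"
      unfolding reply_def winning_def using A by blast
    then show ?thesis by blast
  qed
qed

text \<open>If \<open>U\<close> contains a whole class, colouring it leaves one class; if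
  \<open>U\<close> misses a class, colouring the selected part of the other passes over no vertex.
  Otherwise Painter aims at a singleton class and a single vertex with one selection left.\<close>

lemma reply_fresh:
  assumes "finite A" "finite B" "A \<inter> B = {}" "card A \<le> 2" "card B \<le> 3"
  shows "\<exists>C. reply A B {} U C"
proof -
  have lt: "card (X \<inter> U) < card X" if "\<not> X \<subseteq> U" "finite X" for X :: "'a set"
    using that by (intro psubset_card_mono) auto
  have d: "A - U \<inter> B = A" "B - U \<inter> A = B" "A - U \<inter> A = A - U" "B - U \<inter> B = B - U"
    "(U - U \<inter> A) \<inter> (A \<union> B) = B \<inter> U" "(U - U \<inter> B) \<inter> (A \<union> B) = A \<inter> U"
    using assms by auto
  have c: "card (A - U) = card A - card (A \<inter> U)" "card (B - U) = card B - card (B \<inter> U)"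
    using assms by (simp_all add: card_Diff_subset_Int)
  consider "A \<subseteq> U" | "B \<subseteq> U" | "A \<inter> U = {}" | "B \<inter> U = {}"
    | "\<not> A \<subseteq> U" "\<not> B \<subseteq> U" "A \<inter> U \<noteq> {}" "B \<inter> U \<noteq> {}" by blast
  then show ?thesis
  proof cases
    case 5
    then have *: "card (A \<inter> U) < card A" "card (B \<inter> U) < card B"
      "card (A \<inter> U) > 0" "card (B \<inter> U) > 0"
      using lt assms by (auto simp: card_gt_0_iff)
    \<comment> \<open>Here \<open>A\<close> has two vertices, exactly one of them selected, and one
      or two vertices of \<open>B\<close> are selected. A single one can be passed over; if there
      are two, they are coloured, which leaves at most one vertex of \<open>B\<close>.\<close>
    show ?thesis
    proof (cases "card (B \<inter> U) = 1")
      case True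
      moreover have "card (A - U) \<le> 1" using * c assms by linarith
      ultimately have "reply A B {} U (U \<inter> A)"
        unfolding reply_def winning_def d by simp
      then show ?thesis by blast
    next
      case False
      then have "card (B - U) \<le> 1" "card (A \<inter> U) \<le> 1" using * c assms by linarith+
      then have "reply A B {} U (U \<inter> B)"
        unfolding reply_def winning_def d by simp
      then show ?thesis by blast
    qed
  next
    case 1
    then have "reply A B {} U (U \<inter> A)" unfolding reply_def winning_def by blast
    then show ?thesis by blast
  next
    case 2
    then have "reply A B {} U (U \<inter> B)" unfolding reply_def winning_def by blast
    then show ?thesis by blast
  next
    case 3
    have "card (B - U) \<le> 3" using c assms by simp
    then have "reply A B {} U (U \<inter> B)" unfolding reply_def winning_def d 3 using assms by simp
    then show ?thesis by blast
  next
    case 4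
    have "card (A - U) \<le> 2" using c assms by simp
    then have "reply A B {} U (U \<inter> A)" unfolding reply_def winning_def d 4 using assms by simp
    then show ?thesis by blast
  qed
qed

lemma reply_exists:
  assumes "finite A" "finite B" "A \<inter> B = {}" "D \<subseteq> A \<union> B" "winning A B D"
  shows "\<exists>C. reply A B D U C"
proof -
  have fresh: ?thesis if "A = {} \<or> B = {}"
  proof -
    have "reply A B D U (U \<inter> (if A = {} then B else A))"
      using that unfolding reply_def winning_def by auto
    then show ?thesis by blast
  qed
  show ?thesis
  proof (cases "A = {} \<or> B = {}")
    case False
    then have "card A > 0" "card B > 0" using assms by (auto simp: card_gt_0_iff)
    then consider "card A = 1" "card D \<le> 1" | "card B = 1" "card D \<le> 1"
      | "card A \<le> 2" "card B \<le> 3" "D = {}" | "card B \<le> 2" "card A \<le> 3" "D = {}"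
      using assms(5) False unfolding winning_def by linarith
    then show ?thesis
    proof cases
      case 1 then show ?thesis using reply_star assms by blast
    next
      case 2
      have "\<exists>C. reply B A D U C" using assms 2 by (intro reply_star) auto
      then show ?thesis using reply_commute by blast
    next
      case 3 then show ?thesis using reply_fresh assms by blast
    next
      case 4
      have "\<exists>C. reply B A D U C" unfolding 4 using assms 4 by (intro reply_fresh) auto
      then show ?thesis using reply_commute by blast
    qed
  qed (use fresh in blast)
qed

subsection \<open>Distributing the colour classes over the blocks\<close>

text \<open>In a block 1 a selected vertex must be coloured at once, so the block serves one class.
  In a block 2 no vertex is down to one selection at the start, hence the empty third
  argument.\<close>

definition start :: "nat \<Rightarrow> 'a set \<Rightarrow> 'a set \<Rightarrow> bool" where
  "start k A B \<longleftrightarrow> (k = 1 \<and> B = {}) \<or> (k = 2 \<and> winning A B {})"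

definition slot :: "'a set set \<Rightarrow> nat \<Rightarrow> 'a set \<times> 'a set \<Rightarrow> bool" where
  "slot F k p \<longleftrightarrow> fst p \<in> F \<and> snd p \<in> insert {} F \<and> fst p \<inter> snd p = {} \<and> start k (fst p) (snd p)"

text \<open>Removing two classes lowers \<open>2 * card F + a + 1\<close> by four when
  \<open>a\<close> stays fixed, so the pair should use up at least four vertices. If all classes
  have size at most 2, any two of them will do.\<close>

lemma pair_exists:
  assumes "finite F" "card F = a + 2 * b" "b \<ge> 1" "\<forall>X\<in>F. card X \<ge> 1"
    and le: "sum card F \<le> 2 * card F + a + 1 \<or> (\<forall>X\<in>F. card X \<le> 2)"
  shows "\<exists>X\<in>F. \<exists>Y\<in>F. X \<noteq> Y \<and> winning X Y {} \<and>
     (card X + card Y \<ge> 4 \<or> (\<forall>X\<in>F. card X \<le> 2))"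
proof (cases "\<forall>X\<in>F. card X \<le> 2")
  case True
  have "2 \<le> card F" using assms by simp
  then obtain X Y where "X \<in> F" "Y \<in> F" "X \<noteq> Y"
    using card_le_Suc0_iff_eq[OF \<open>finite F\<close>] by fastforce
  moreover have "card X \<le> 2" "card Y \<le> 3" using True \<open>X \<in> F\<close> \<open>Y \<in> F\<close> by force+
  ultimately show ?thesis using True unfolding winning_def by blast
next
  case False
  then obtain X where X: "X \<in> F" "card X \<ge> 3" by force
  have sum_le: "sum card F \<le> 2 * card F + a + 1" using le False by blast
  show ?thesis
  proof (cases "\<exists>Y\<in>F. card Y = 1")
    case True
    then obtain Y where Y: "Y \<in> F" "card Y = 1" by blast
    then have "X \<noteq> Y" "winning X Y {}" "card X + card Y \<ge> 4"
      using X unfolding winning_def by auto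
    then show ?thesis using X Y by blast
  next
    case no1: False
    then have ge2: "card Y \<ge> 2" if "Y \<in> F" for Y using assms(4) that
      by (metis Suc_1 le_antisym not_less_eq_eq)
    define T where "T = {Y\<in>F. card Y = 2}"
    have fT: "finite T" using assms by (simp add: T_def)
    show ?thesis
    proof (cases "card T \<le> 1")
      case False
      then obtain Y Z where "Y \<in> T" "Z \<in> T" "Y \<noteq> Z"
        using card_le_Suc0_iff_eq[OF fT] by force
      then have "winning Y Z {}" "card Y + card Z \<ge> 4" "Y \<in> F" "Z \<in> F"
        unfolding T_def winning_def by auto
      then show ?thesis using \<open>Y \<noteq> Z\<close> by blast
    next
      case True
      \<comment> \<open>Counting classes of size 2 as if they had size 3 gives every class weight at
        least 3, at the price of adding \<open>card T\<close>.\<close>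
      define g where "g Y = card Y + (if Y \<in> T then 1 else 0)" for Y
      have g3: "3 \<le> g Y" if "Y \<in> F" for Y
        using ge2[OF that] that by (auto simp: g_def T_def)
      have "F \<inter> T = T" by (auto simp: T_def)
      then have sg: "sum g F = sum card F + card T"
        unfolding g_def sum.distrib using assms(1) by (simp add: sum.If_cases)
      have "g X + (\<Sum>Y\<in>F - {X}. 3) \<le> g X + sum g (F - {X})"
        using g3 by (intro add_left_mono sum_mono) auto
      also have "\<dots> = sum g F" using assms(1) X(1) by (simp add: sum.remove)
      finally have "g X + 3 * (card F - 1) \<le> sum card F + card T"
        using sg X assms(1) by simp
      then have *: "g X + 3 * (card F - 1) \<le> 2 * card F + a + 1 + card T" using sum_le by linarith
      have "g X = card X" using X by (simp add: g_def T_def)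
      \<comment> \<open>The inequality amounts to \<open>card X + 2 * b \<le> 4 + card T\<close>,
        where \<open>card X \<ge> 3\<close>, \<open>b \<ge> 1\<close> and
        \<open>card T \<le> 1\<close>.\<close>
      then have "card X = 3" "card T = 1" using * True X assms(2,3) by linarith+
      then have "T \<noteq> {}" by auto
      then obtain Y where "Y \<in> F" "card Y = 2" unfolding T_def by blast
      then have "X \<noteq> Y" "winning X Y {}" "card X + card Y \<ge> 4"
        using \<open>card X = 3\<close> unfolding winning_def by auto
      then show ?thesis using X \<open>Y \<in> F\<close> by blast
    qed
  qed
qed

lemma sum_list_ones_twos:
  "set ks \<subseteq> {1, 2} \<Longrightarrow> sum_list ks = count_list ks 1 + 2 * count_list ks 2"
  by (induction ks) auto

text \<open>The final disjunction is the invariant of the greedy choice. A block 1 lowers the bound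
  by three: a largest class pays for this unless all classes have size at most 2. A block 2 lowers
  it by four, which the chosen pair pays with the same exception.\<close>

lemma slots_exist:
  assumes "finite F" "card F = sum_list ks" "set ks \<subseteq> {1, 2}" "\<forall>X\<in>F. card X \<ge> 1"
    and "disjoint F"
    and "sum card F \<le> 2 * card F + count_list ks 1 + 1 \<or> (\<forall>X\<in>F. card X \<le> 2)"
  shows "\<exists>P. list_all2 (slot F) ks P \<and> F \<subseteq> (\<Union>(A, B)\<in>set P. {A, B})"
  using assms
proof (induction ks arbitrary: F)
  case Nil
  then show ?case by simp
next
  case (Cons k ks)
  have mono: "list_all2 (slot F) ks P" if "list_all2 (slot F') ks P" "F' \<subseteq> F" for F' P
    using that(1) by (rule list_all2_mono) (use that(2) in \<open>auto simp: slot_def\<close>)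
  have sub: "disjoint (F - G)" for G
    using Cons.prems(5) by (meson Diff_subset pairwise_subset)
  consider "k = 1" | "k = 2" using Cons.prems(3) by auto
  then show ?case
  proof cases
    case 1
    have "card F > 0" using Cons.prems(2) 1 by simp
    then have "F \<noteq> {}" by auto
    have "Max (card ` F) \<in> card ` F" using \<open>F \<noteq> {}\<close> Cons.prems(1) by simp
    then obtain X where "X \<in> F" "card X = Max (card ` F)" by auto
    then have X: "X \<in> F" "\<And>Y. Y \<in> F \<Longrightarrow> card Y \<le> card X"
      using Cons.prems(1) by simp_all
    have cF: "card (F - {X}) = sum_list ks" "card F = Suc (sum_list ks)"
      using X Cons.prems 1 by auto
    have s: "sum card F = card X + sum card (F - {X})" using X Cons.prems(1) by (simp add: sum.remove)
    have "sum card (F - {X}) \<le> 2 * card (F - {X}) + count_list ks 1 + 1 \<or> (\<forall>Y\<in>F - {X}. card Y \<le> 2)"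
    proof (cases "card X \<le> 2")
      case True
      then show ?thesis using X(2) le_trans by blast
    next
      case False
      then have "sum card F \<le> 2 * card F + count_list (k # ks) 1 + 1" using X Cons.prems(6) by blast
      then show ?thesis using s cF 1 False by simp
    qed
    then obtain P where P: "list_all2 (slot (F - {X})) ks P" "F - {X} \<subseteq> (\<Union>(A, B)\<in>set P. {A, B})"
      using Cons.IH[of "F - {X}"] Cons.prems cF sub by auto
    have "slot F k (X, {})" using X 1 by (simp add: slot_def start_def)
    then have "list_all2 (slot F) (k # ks) ((X, {}) # P)" using mono[OF P(1)] by auto
    moreover have "F \<subseteq> (\<Union>(A, B)\<in>set ((X, {}) # P). {A, B})" using P(2) by auto
    ultimately show ?thesis by blast
  next
    case 2
    let ?a = "count_list ks 1" and ?b = "Suc (count_list ks 2)"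
    have cF: "card F = ?a + 2 * ?b" "card F = sum_list ks + 2"
      using Cons.prems(2,3) sum_list_ones_twos[of ks] 2 by auto
    obtain X Y where XY: "X \<in> F" "Y \<in> F" "X \<noteq> Y" "winning X Y {}"
      "card X + card Y \<ge> 4 \<or> (\<forall>X\<in>F. card X \<le> 2)"
    proof -
      have le: "sum card F \<le> 2 * card F + ?a + 1 \<or> (\<forall>X\<in>F. card X \<le> 2)"
        using Cons.prems(6) 2 by simp
      show thesis using pair_exists[OF Cons.prems(1) cF(1) _ Cons.prems(4) le] that by auto
    qed
    have d: "X \<inter> Y = {}" using XY Cons.prems(5) by (auto simp: disjoint_def)
    have "F - {X, Y} = F - {X} - {Y}" by auto
    then have s: "sum card F = card X + card Y + sum card (F - {X, Y})"
      using XY(1-3) sum.remove[of F X card] sum.remove[of "F - {X}" Y card] Cons.prems(1)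
      by (metis Diff_iff add.assoc finite_Diff singletonD)
    have c: "card (F - {X, Y}) = sum_list ks" using XY Cons.prems(1) cF(2) by (simp add: card_Diff_subset)
    have "sum card (F - {X, Y}) \<le> 2 * card (F - {X, Y}) + count_list ks 1 + 1 \<or> (\<forall>Z\<in>F - {X, Y}. card Z \<le> 2)"
      using XY(5) Cons.prems(6) s c cF 2 by auto
    then obtain P where P: "list_all2 (slot (F - {X, Y})) ks P" "F - {X, Y} \<subseteq> (\<Union>(A, B)\<in>set P. {A, B})"
      using Cons.IH[of "F - {X, Y}"] Cons.prems c sub by auto
    have "slot F k (X, Y)" using XY 2 d by (simp add: slot_def start_def)
    then have "list_all2 (slot F) (k # ks) ((X, Y) # P)" using mono[OF P(1)] by auto
    moreover have "F \<subseteq> (\<Union>(A, B)\<in>set ((X, Y) # P). {A, B})" using P(2) by auto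
    ultimately show ?thesis by blast
  qed
qed

subsection \<open>Combining the blocks\<close>

lemma coloured_append [simp]: "coloured (g @ h) = coloured g \<union> coloured h"
  by (auto simp: coloured_def)

lemma coloured_Nil [simp]: "coloured [] = {}"
  by (simp add: coloured_def)

lemma coloured_Cons [simp]: "coloured (r # h) = snd r \<union> coloured h"
  by (simp add: coloured_def)

lemma selections_append [simp]: "selections (g @ h) v = selections g v + selections h v"
  by (simp add: selections_def)

lemma selections_Nil [simp]: "selections [] v = 0"
  by (simp add: selections_def)

lemma selections_Cons [simp]:
  "selections (r # h) v = (if v \<in> fst r then Suc (selections h v) else selections h v)"
  by (simp add: selections_def)

lemma selections_take_le: "selections (take n h) v \<le> selections h v"
  by (metis append_take_drop_id le_add1 selections_append)

lemma independent_set_subset: "independent_set E I \<Longrightarrow> J \<subseteq> I \<Longrightarrow> independent_set E J"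
  unfolding independent_set_def by blast

text \<open>Colouring requires selection and selection requires a token. Hence a win of Lister at
  any prefix is still visible at the end of the play.\<close>

lemma exhausted_stays_uncoloured:
  assumes "painting_play V E k h" "n \<le> length h" "v \<notin> coloured (take n h)"
    "selections (take n h) v \<ge> k"
  shows "v \<notin> coloured h"
proof
  assume "v \<in> coloured h"
  then obtain m where m: "m < length h" "v \<in> snd (h ! m)"
    by (auto simp: coloured_def in_set_conv_nth)
  have "m \<ge> n"
  proof (rule ccontr)
    assume "\<not> n \<le> m"
    then have "take n h ! m = h ! m" "m < length (take n h)" using m by auto
    then have "h ! m \<in> set (take n h)" by (metis nth_mem)
    then show False using assms(3) m by (auto simp: coloured_def)
  qed
  then have "selections (take m h) v \<ge> k"
    using assms(4) selections_take_le[of n "take m h" v] by (simp add: min_absorb1)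
  moreover have "v \<in> fst (h ! m)" "tokens k (take m h) v > 0"
    using assms(1) m unfolding painting_play_def by (auto simp: case_prod_beta)
  ultimately show False by (simp add: tokens_def)
qed

lemma sum_list_take_Suc: "i < length ks \<Longrightarrow> sum_list (take (Suc i) ks) = sum_list (take i ks) + (ks ! i :: nat)"
  by (simp add: take_Suc_conv_app_nth)

lemma sum_list_take_mono: "i \<le> j \<Longrightarrow> sum_list (take i ks) \<le> sum_list (take j (ks :: nat list))"
  by (metis append_take_drop_id le_add1 min_absorb1 sum_list_append take_take)

text \<open>Painter cannot see the block boundaries, but the number of times that a selectable vertex has
  been selected determines the current block.\<close>

definition block_at :: "nat list \<Rightarrow> nat \<Rightarrow> nat" where
  "block_at ks n = (LEAST i. n < sum_list (take (Suc i) ks))"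

lemma block_at_eq:
  assumes "sum_list (take i ks) \<le> n" "n < sum_list (take (Suc i) ks)"
  shows "block_at ks n = i"
  unfolding block_at_def
proof (rule Least_equality)
  fix j assume "n < sum_list (take (Suc j) ks)"
  then have "\<not> sum_list (take (Suc j) ks) \<le> sum_list (take i ks)" using assms(1) by linarith
  then have "\<not> Suc j \<le> i" using sum_list_take_mono by blast
  then show "i \<le> j" by simp
qed (use assms in simp)

text \<open>With \<open>K\<close> the number of selections due by the end of the current block,
  these vertices have exactly one selection left in it.\<close>

definition urgent :: "nat \<Rightarrow> 'a round list \<Rightarrow> 'a set \<Rightarrow> 'a set" where
  "urgent K h M = {v \<in> M. Suc (selections h v) = K}"

definition block_reply ::
    "(nat \<Rightarrow> 'a set) \<Rightarrow> (nat \<Rightarrow> 'a set) \<Rightarrow> nat list \<Rightarrow> nat \<Rightarrow> 'a round list \<Rightarrow> 'a set \<Rightarrow> 'a set \<Rightarrow> bool" where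
  "block_reply A B ks i h U C \<longleftrightarrow>
     reply (A i - coloured h) (B i - coloured h)
       (urgent (sum_list (take (Suc i) ks)) h (A i \<union> B i - coloured h)) U C"

text \<open>Any selected vertex reveals the current block, so an arbitrary one is inspected. The
  default \<open>{}\<close> makes this a legal strategy on all histories.\<close>

definition slot_strategy ::
    "'a set set \<Rightarrow> (nat \<Rightarrow> 'a set) \<Rightarrow> (nat \<Rightarrow> 'a set) \<Rightarrow> nat list \<Rightarrow> 'a round list \<Rightarrow> 'a set \<Rightarrow> 'a set" where
  "slot_strategy E A B ks h U =
     (let C = SOME C. block_reply A B ks (block_at ks (selections h (SOME v. v \<in> U))) h U C
      in if C \<subseteq> U \<and> independent_set E C then C else {})"

lemma painter_strategy_slot_strategy: "painter_strategy E (slot_strategy E A B ks)"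
  unfolding painter_strategy_def slot_strategy_def independent_set_def by (auto simp: Let_def)

text \<open>Within block \<open>i\<close> the position on \<open>A i\<close> and \<open>B i\<close>
  stays winning and every uncoloured vertex there keeps a selection. At the end of the block an
  uncoloured vertex would have none, so both sets are coloured by then.\<close>

lemma painter_wins_slots:
  assumes fin: "finite V"
    and sub: "\<And>i. i < length ks \<Longrightarrow> A i \<subseteq> V \<and> B i \<subseteq> V \<and> A i \<inter> B i = {}"
    and ind: "\<And>i. i < length ks \<Longrightarrow> independent_set E (A i) \<and> independent_set E (B i)"
    and start: "\<And>i. i < length ks \<Longrightarrow> start (ks ! i) (A i) (B i)"
    and cover: "V \<subseteq> (\<Union>i<length ks. A i \<union> B i)"
  shows "painter_wins_block_game V E ks"
  unfolding painter_wins_block_game_def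
proof (intro exI conjI allI impI)
  let ?\<sigma> = "slot_strategy E A B ks"
  show "painter_strategy E ?\<sigma>" by (rule painter_strategy_slot_strategy)
  fix h
  assume "painting_play V E (sum_list ks) h \<and> respects_blocks V ks h \<and> follows_strategy ?\<sigma> h"
  then have play: "painting_play V E (sum_list ks) h" and blk: "respects_blocks V ks h"
    and fol: "follows_strategy ?\<sigma> h" by auto
  obtain bs where bs: "concat bs = h" "length bs = length ks"
    and le: "\<And>i v. i < length ks \<Longrightarrow> v \<in> V \<Longrightarrow> selections (bs ! i) v \<le> ks ! i"
    and eq: "\<And>i v. i < length ks \<Longrightarrow> v \<in> V \<Longrightarrow> v \<notin> coloured (concat (take (Suc i) bs)) \<Longrightarrow>
      selections (bs ! i) v = ks ! i"
    using blk unfolding respects_blocks_def by blast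
  define K where "K i = sum_list (take i ks)" for i
  have Suc_bs: "concat (take (Suc i) bs) = concat (take i bs) @ bs ! i" if "i < length ks" for i
    using that bs(2) by (simp add: take_Suc_conv_app_nth)
  have sel: "selections (concat (take j bs)) v = K j"
    if "j \<le> length ks" "v \<in> V" "v \<notin> coloured (concat (take j bs))" for j v
    using that
  proof (induction j)
    case (Suc j)
    then have "j < length ks" "v \<notin> coloured (concat (take j bs))" by (auto simp: Suc_bs)
    with Suc eq[of j v] show ?case
      by (simp add: Suc_bs K_def sum_list_take_Suc)
  qed (simp add: K_def)
  have block: "v \<in> coloured h" if i: "i < length ks" and v: "v \<in> A i \<union> B i" for i v
  proof -
    let ?p = "concat (take i bs)" and ?b = "bs ! i"
    define g where "g m = ?p @ take m ?b" for m
    have h: "h = ?p @ ?b @ concat (drop (Suc i) bs)"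
      using bs i by (metis append_take_drop_id concat.simps(2) concat_append Cons_nth_drop_Suc)
    have KS: "K (Suc i) = K i + ks ! i" using i by (simp add: K_def sum_list_take_Suc)
    have "winning (A i - coloured (g m)) (B i - coloured (g m)) (urgent (K (Suc i)) (g m) (A i \<union> B i - coloured (g m)))
      \<and> (\<forall>v \<in> A i \<union> B i - coloured (g m). selections (g m) v < K (Suc i))" (is "?W m \<and> ?T m")
      if "m \<le> length ?b" for m
      using that
    proof (induction m)
      case 0
      have fAB: "finite (A i)" "finite (B i)" using sub[OF i] fin finite_subset by blast+
      have s: "selections ?p v = K i" if "v \<in> A i \<union> B i - coloured ?p" for v
        using that sel[of i v] i sub[OF i] by auto
      have "?T 0" using s start[OF i] by (auto simp: g_def start_def KS)
      \<comment> \<open>In a block 1 all vertices are urgent, but the second class is empty, which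
        makes the position winning.\<close>
      moreover have "?W 0"
      proof (cases "ks ! i = 1")
        case True
        then show ?thesis using start[OF i] by (simp add: start_def winning_def)
      next
        case False
        then have "ks ! i = 2" "winning (A i) (B i) {}" using start[OF i] by (auto simp: start_def)
        moreover from this have "urgent (K (Suc i)) (g 0) (A i \<union> B i - coloured (g 0)) = {}"
          using s by (auto simp: urgent_def g_def KS)
        ultimately show ?thesis using winning_mono[of "A i" "B i" "{}"] fAB by auto
      qed
      ultimately show ?case by blast
    next
      case (Suc m)
      obtain U C where UC: "?b ! m = (U, C)" by fastforce
      have g_Suc: "g (Suc m) = g m @ [(U, C)]"
        using Suc.prems UC by (simp add: g_def take_Suc_conv_app_nth)
      define n where "n = length ?p + m"
      have n: "n < length h" "h ! n = (U, C)" "take n h = g m"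
        using Suc.prems UC by (auto simp: n_def h nth_append g_def)
      have U: "U \<noteq> {}" "U \<subseteq> V - coloured (g m)" "C \<subseteq> U"
        using play n unfolding painting_play_def by force+
      have C: "C = ?\<sigma> (g m) U" using fol n unfolding follows_strategy_def by (metis fst_conv snd_conv)
      \<comment> \<open>Before the block each vertex of \<open>U\<close> was selected exactly
        \<open>K i\<close> times, and the block bound still leaves room for the present
        selection.\<close>
      have "block_at ks (selections (g m) u) = i" if u: "u \<in> U" for u
      proof (rule block_at_eq)
        have "u \<in> V" "u \<notin> coloured ?p" using u U by (auto simp: g_def)
        then have "selections ?p u = K i" using sel i by simp
        then show "sum_list (take i ks) \<le> selections (g m) u" by (simp add: g_def K_def)
        have "Suc (selections (take m ?b) u) \<le> ks ! i"
          using selections_take_le[of "Suc m" ?b u] le[OF i \<open>u \<in> V\<close>] Suc.prems UC u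
          by (simp add: take_Suc_conv_app_nth)
        then show "selections (g m) u < sum_list (take (Suc i) ks)"
          using KS \<open>selections ?p u = K i\<close> by (simp add: g_def K_def)
      qed
      then have at: "block_at ks (selections (g m) (SOME v. v \<in> U)) = i"
        using U(1) by (simp add: some_in_eq)
      let ?A = "A i - coloured (g m)" and ?B = "B i - coloured (g m)"
      let ?D = "urgent (K (Suc i)) (g m) (A i \<union> B i - coloured (g m))"
      have fAB: "finite ?A" "finite ?B" "finite ?D"
        using sub[OF i] fin finite_subset[of _ V] by (auto simp: urgent_def)
      have IH: "?W m" "?T m" using Suc by auto
      have "\<exists>C. reply ?A ?B ?D U C"
        using IH sub[OF i] fAB by (intro reply_exists) (auto simp: urgent_def)
      then have "\<exists>C. block_reply A B ks i (g m) U C" unfolding block_reply_def K_def by blast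
      then have "block_reply A B ks i (g m) U (SOME C. block_reply A B ks i (g m) U C)"
        by (rule someI_ex)
      moreover define C' where "C' = (SOME C. block_reply A B ks i (g m) U C)"
      ultimately have br: "block_reply A B ks i (g m) U C'" by simp
      then have "C' \<subseteq> A i \<or> C' \<subseteq> B i" and "C' \<subseteq> U"
        unfolding block_reply_def reply_def by blast+
      \<comment> \<open>The chosen reply lies inside one class and so is independent; the strategy
        does not fall back on \<open>{}\<close>.\<close>
      then have "C' \<subseteq> U \<and> independent_set E C'"
        using ind[OF i] independent_set_subset by blast
      then have "C = C'"
        unfolding C slot_strategy_def at Let_def C'_def by simp
      then have rep: "reply ?A ?B ?D U C" using br by (simp add: block_reply_def K_def)
      have AB: "A i - coloured (g (Suc m)) = ?A - C" "B i - coloured (g (Suc m)) = ?B - C"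
        by (auto simp: g_Suc)
      \<comment> \<open>A newly urgent vertex was selected and passed over in this round.\<close>
      have "urgent (K (Suc i)) (g (Suc m)) (A i \<union> B i - coloured (g (Suc m)))
          \<subseteq> ?D - C \<union> (U - C) \<inter> (?A \<union> ?B)"
        by (auto simp: urgent_def g_Suc split: if_splits)
      moreover have "finite (?D - C \<union> (U - C) \<inter> (?A \<union> ?B))" using fAB by auto
      moreover have "winning (?A - C) (?B - C) (?D - C \<union> (U - C) \<inter> (?A \<union> ?B))"
        using rep by (simp add: reply_def)
      ultimately have "?W (Suc m)" unfolding AB using fAB winning_mono by blast
      moreover have "?T (Suc m)"
      proof
        fix v assume v: "v \<in> A i \<union> B i - coloured (g (Suc m))"
        then have v': "v \<in> ?A \<union> ?B" "v \<notin> C" by (auto simp: g_Suc)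
        then have *: "selections (g m) v < K (Suc i)" using IH(2) by blast
        have "Suc (selections (g m) v) \<noteq> K (Suc i)" if "v \<in> U"
          using rep v' that unfolding reply_def urgent_def by blast
        then show "selections (g (Suc m)) v < K (Suc i)" using * by (auto simp: g_Suc)
      qed
      ultimately show ?case by blast
    qed
    from this[of "length ?b"] have T: "?T (length ?b)" by blast
    have "v \<in> coloured (concat (take (Suc i) bs))"
    proof (rule ccontr)
      assume n: "v \<notin> coloured (concat (take (Suc i) bs))"
      moreover have "v \<in> V" using v sub[OF i] by blast
      ultimately have "selections (concat (take (Suc i) bs)) v = K (Suc i)" using sel[of "Suc i" v] i by simp
      moreover have "g (length ?b) = concat (take (Suc i) bs)" using i by (simp add: g_def Suc_bs)
      ultimately show False using bspec[OF T, of v] n v by simp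
    qed
    then show ?thesis using h i by (simp add: Suc_bs) (metis Un_iff coloured_append)
  qed
  show "\<not> lister_wins V (sum_list ks) h"
  proof
    assume "lister_wins V (sum_list ks) h"
    then obtain n v where "n \<in> {1..length h}" "v \<in> V - coloured (take n h)"
      "tokens (sum_list ks) (take n h) v = 0"
      unfolding lister_wins_def by blast
    then have "v \<in> V" "v \<notin> coloured h"
      using exhausted_stays_uncoloured[OF play, of n v] by (auto simp: tokens_def)
    then show False using cover block by blast
  qed
qed

section \<open>Painter's win on graphs with few vertices\<close>

lemma paintable_of_small:
  assumes "simple_graph V E" "chromatic_number V E = sum_mset L" "set_mset L \<subseteq> {1, 2}"
    "card V \<le> 2 * sum_mset L + count L 1 + 1"
  shows "paintable V E L"
proof -
  let ?k = "sum_mset L"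
  have fin: "finite V" using assms(1) by (simp add: simple_graph_def)
  have no_loop: "u \<noteq> v" if "{u, v} \<in> E" for u v
    using that assms(1) by (force simp: simple_graph_def)
  obtain f :: "'a \<Rightarrow> nat" where f: "bij_betw f V {0..<card V}"
    using ex_bij_betw_finite_nat[OF fin] by blast
  \<comment> \<open>Some proper colouring exists, so the least number of colours is
    attained.\<close>
  have "proper_colouring V E (card V) f"
    unfolding proper_colouring_def using f no_loop by (auto simp: bij_betw_def dest: inj_onD)
  then obtain c where c: "proper_colouring V E ?k c"
    using LeastI_ex[of "\<lambda>k. \<exists>c. proper_colouring V E k c"] assms(2)
    unfolding chromatic_number_def by auto
  have least: "?k \<le> k" if "proper_colouring V E k c" for k c
    using assms(2) that unfolding chromatic_number_def by (metis (mono_tags) Least_le)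
  define cls where "cls j = {v \<in> V. c v = j}" for j
  have nonempty: "cls j \<noteq> {}" if j: "j < ?k" for j
  proof
    assume e: "cls j = {}"
    have "proper_colouring V E (?k - 1) (\<lambda>v. if c v = ?k - 1 then j else c v)"
      unfolding proper_colouring_def
    proof (intro conjI ballI impI)
      fix v assume "v \<in> V"
      then have "c v < ?k" "c v \<noteq> j" using c e by (auto simp: proper_colouring_def cls_def)
      then show "(if c v = ?k - 1 then j else c v) < ?k - 1" using j by auto
    next
      fix u v assume "u \<in> V" "v \<in> V" "{u, v} \<in> E"
      then have "c u \<noteq> c v" "c u \<noteq> j" "c v \<noteq> j" using c e by (auto simp: proper_colouring_def cls_def)
      then show "(if c u = ?k - 1 then j else c u) \<noteq> (if c v = ?k - 1 then j else c v)" by auto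
    qed
    then have "?k \<le> ?k - 1" by (rule least)
    then show False using j by linarith
  qed
  define F where "F = cls ` {..<?k}"
  have inj: "inj_on cls {..<?k}"
  proof (rule inj_onI)
    fix i j assume ij: "i \<in> {..<?k}" "cls i = cls j"
    then obtain v where "v \<in> cls i" "v \<in> cls j" using nonempty by blast
    then show "i = j" by (simp add: cls_def)
  qed
  have F: "finite F" "card F = ?k" "\<Union>F = V"
  proof -
    show "finite F" "card F = ?k" using card_image[OF inj] by (simp_all add: F_def)
    show "\<Union>F = V" using c by (auto simp: F_def cls_def proper_colouring_def)
  qed
  have cls_independent: "independent_set E (cls j)" for j
    unfolding independent_set_def
  proof (intro ballI)
    fix u v assume "u \<in> cls j" "v \<in> cls j"
    then have "u \<in> V" "v \<in> V" "c u = c v" by (auto simp: cls_def)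
    then show "{u, v} \<notin> E" using c unfolding proper_colouring_def by blast
  qed
  have fX: "finite X" "X \<noteq> {}" "X \<subseteq> V" "independent_set E X" if X: "X \<in> F" for X
  proof -
    obtain j where j: "j < ?k" "X = cls j" using X by (auto simp: F_def)
    show "X \<noteq> {}" "independent_set E X" using j nonempty cls_independent by auto
    show "X \<subseteq> V" using j by (auto simp: cls_def)
    then show "finite X" using fin finite_subset by blast
  qed
  have disj: "disjoint F" by (auto simp: disjoint_def F_def cls_def)
  have "card V = sum card F"
    using card_Union_disjoint[OF disj fX(1)] F(3) by simp
  show ?thesis
    unfolding paintable_def
  proof (intro allI impI)
    fix ks assume ks: "mset ks = L"
    have "\<exists>P. list_all2 (slot F) ks P \<and> F \<subseteq> (\<Union>(A, B)\<in>set P. {A, B})"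
    proof (rule slots_exist)
      show "card F = sum_list ks" using F ks by (metis sum_mset_sum_list)
      show "set ks \<subseteq> {1, 2}" using assms(3) ks by auto
      show "\<forall>X\<in>F. card X \<ge> 1" using fX by (auto simp: Suc_le_eq card_gt_0_iff)
      have "count_list ks 1 = count L 1" using ks by (metis count_mset)
      then show "sum card F \<le> 2 * card F + count_list ks 1 + 1 \<or> (\<forall>X\<in>F. card X \<le> 2)"
        using assms(4) \<open>card V = sum card F\<close> F by simp
    qed (use F disj in auto)
    then obtain P where P: "list_all2 (slot F) ks P" "F \<subseteq> (\<Union>(A, B)\<in>set P. {A, B})" by blast
    then have len: "length P = length ks" by (simp add: list_all2_lengthD)
    have slot: "slot F (ks ! i) (P ! i)" if "i < length ks" for i
      using P(1) that by (simp add: list_all2_conv_all_nth)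
    show "painter_wins_block_game V E ks"
    proof (rule painter_wins_slots[where A = "\<lambda>i. fst (P ! i)" and B = "\<lambda>i. snd (P ! i)"])
      have "independent_set E {}" by (simp add: independent_set_def)
      then show "independent_set E (fst (P ! i)) \<and> independent_set E (snd (P ! i))" if "i < length ks" for i
        using slot[OF that] fX by (auto simp: slot_def)
      show "fst (P ! i) \<subseteq> V \<and> snd (P ! i) \<subseteq> V \<and> fst (P ! i) \<inter> snd (P ! i) = {}" if "i < length ks" for i
        using slot[OF that] fX(3) by (auto simp: slot_def)
      show "start (ks ! i) (fst (P ! i)) (snd (P ! i))" if "i < length ks" for i
        using slot[OF that] by (simp add: slot_def)
      show "V \<subseteq> (\<Union>i<length ks. fst (P ! i) \<union> snd (P ! i))"
      proof
        fix v assume "v \<in> V"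
        then obtain X where "X \<in> F" "v \<in> X" using F(3) by blast
        moreover from this(1) P(2) have "X \<in> (\<Union>p\<in>set P. {fst p, snd p})"
          by (auto simp: case_prod_beta)
        ultimately obtain p where "p \<in> set P" "v \<in> fst p \<union> snd p" by blast
        then show "v \<in> (\<Union>i<length ks. fst (P ! i) \<union> snd (P ! i))"
          using len by (auto simp: in_set_conv_nth)
      qed
    qed (rule fin)
  qed
qed

subsection \<open>Lister's round plans fixed in advance\<close>

text \<open>The planned sets are played in order, without their coloured vertices; a set with no
  uncoloured vertex is skipped, since a selection must be nonempty.\<close>

fun reveal :: "('a round list \<Rightarrow> 'a set \<Rightarrow> 'a set) \<Rightarrow> 'a round list \<Rightarrow> 'a set list \<Rightarrow> 'a round list" where
  "reveal \<sigma> h [] = []"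
| "reveal \<sigma> h (S # Ss) =
    (let U = S - coloured h
     in if U = {} then reveal \<sigma> h Ss else (U, \<sigma> h U) # reveal \<sigma> (h @ [(U, \<sigma> h U)]) Ss)"

text \<open>The same play cut at the block boundaries, as the witness for
  \<open>respects_blocks\<close>.\<close>

fun reveal_blocks ::
    "('a round list \<Rightarrow> 'a set \<Rightarrow> 'a set) \<Rightarrow> 'a round list \<Rightarrow> 'a set list list \<Rightarrow> 'a round list list" where
  "reveal_blocks \<sigma> h [] = []"
| "reveal_blocks \<sigma> h (Ss # Sss) = reveal \<sigma> h Ss # reveal_blocks \<sigma> (h @ reveal \<sigma> h Ss) Sss"

definition multiplicity_in :: "'a set list \<Rightarrow> 'a \<Rightarrow> nat" where
  "multiplicity_in Ss v = length (filter (\<lambda>S. v \<in> S) Ss)"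

lemma reveal_append: "reveal \<sigma> h (Ss @ Ts) = reveal \<sigma> h Ss @ reveal \<sigma> (h @ reveal \<sigma> h Ss) Ts"
  by (induction \<sigma> h Ss rule: reveal.induct) (auto simp: Let_def)

lemma concat_reveal_blocks: "concat (reveal_blocks \<sigma> h Sss) = reveal \<sigma> h (concat Sss)"
  by (induction \<sigma> h Sss rule: reveal_blocks.induct) (auto simp: reveal_append)

lemma length_reveal_blocks [simp]: "length (reveal_blocks \<sigma> h Sss) = length Sss"
  by (induction \<sigma> h Sss rule: reveal_blocks.induct) auto

lemma take_reveal_blocks: "take n (reveal_blocks \<sigma> h Sss) = reveal_blocks \<sigma> h (take n Sss)"
proof (induction \<sigma> h Sss arbitrary: n rule: reveal_blocks.induct)
  case (2 \<sigma> h Ss Sss)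
  then show ?case by (cases n) auto
qed simp

lemma nth_reveal_blocks:
  "i < length Sss \<Longrightarrow>
    reveal_blocks \<sigma> h Sss ! i = reveal \<sigma> (h @ reveal \<sigma> h (concat (take i Sss))) (Sss ! i)"
proof (induction \<sigma> h Sss arbitrary: i rule: reveal_blocks.induct)
  case (2 \<sigma> h Ss Sss)
  then show ?case by (cases i) (auto simp: reveal_append)
qed simp

lemma selections_reveal_le: "selections (reveal \<sigma> h Ss) v \<le> multiplicity_in Ss v"
  by (induction \<sigma> h Ss rule: reveal.induct) (auto simp: Let_def multiplicity_in_def intro: le_SucI)

text \<open>An uncoloured vertex is never removed from a planned set, and no set containing it is
  skipped.\<close>

lemma selections_reveal_eq:
  "v \<notin> coloured h \<Longrightarrow> v \<notin> coloured (reveal \<sigma> h Ss) \<Longrightarrow>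
    selections (reveal \<sigma> h Ss) v = multiplicity_in Ss v"
  by (induction \<sigma> h Ss rule: reveal.induct)
    (auto simp: Let_def multiplicity_in_def split: if_splits)

lemma respects_blocks_reveal:
  assumes "length Sss = length ks"
    and "\<And>i v. i < length ks \<Longrightarrow> v \<in> V \<Longrightarrow> multiplicity_in (Sss ! i) v = ks ! i"
  shows "respects_blocks V ks (reveal \<sigma> [] (concat Sss))"
  unfolding respects_blocks_def
proof (intro exI[of _ "reveal_blocks \<sigma> [] Sss"] conjI allI impI ballI)
  fix i v assume i: "i < length ks" and v: "v \<in> V"
  let ?h = "reveal \<sigma> [] (concat (take i Sss))"
  have nth: "reveal_blocks \<sigma> [] Sss ! i = reveal \<sigma> ?h (Sss ! i)"
    using i assms(1) by (simp add: nth_reveal_blocks)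
  then show "selections (reveal_blocks \<sigma> [] Sss ! i) v \<le> ks ! i"
    using selections_reveal_le assms(2)[OF i v] by metis
  assume "v \<notin> coloured (concat (take (Suc i) (reveal_blocks \<sigma> [] Sss)))"
  then have "v \<notin> coloured ?h" "v \<notin> coloured (reveal \<sigma> ?h (Sss ! i))"
    using i assms(1)
    by (auto simp: take_reveal_blocks concat_reveal_blocks take_Suc_conv_app_nth reveal_append)
  then show "selections (reveal_blocks \<sigma> [] Sss ! i) v = ks ! i"
    using nth selections_reveal_eq assms(2)[OF i v] by metis
qed (use assms in \<open>auto simp: concat_reveal_blocks\<close>)

lemma follows_strategy_snoc:
  "follows_strategy \<sigma> (h @ [(U, I)]) \<longleftrightarrow> follows_strategy \<sigma> h \<and> I = \<sigma> h U"
  unfolding follows_strategy_def by (auto simp: nth_append less_Suc_eq)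

lemma painting_play_snoc:
  "painting_play V E k (h @ [(U, I)]) \<longleftrightarrow> painting_play V E k h \<and>
    U \<noteq> {} \<and> U \<subseteq> V - coloured h \<and> (\<forall>v\<in>U. tokens k h v > 0) \<and> I \<subseteq> U \<and> independent_set E I"
  unfolding painting_play_def by (auto simp: nth_append less_Suc_eq case_prod_beta)

text \<open>The last hypothesis adds the selections made to those still planned, so it survives the
  induction and provides a token for each selection.\<close>

lemma reveal_play:
  assumes "painter_strategy E \<sigma>" "painting_play V E k h" "follows_strategy \<sigma> h"
    and "\<And>S. S \<in> set Ss \<Longrightarrow> S \<subseteq> V"
    and "\<And>v. v \<in> V \<Longrightarrow> selections h v + multiplicity_in Ss v \<le> k"
  shows "painting_play V E k (h @ reveal \<sigma> h Ss) \<and> follows_strategy \<sigma> (h @ reveal \<sigma> h Ss)"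
  using assms
proof (induction \<sigma> h Ss rule: reveal.induct)
  case (2 \<sigma> h S Ss)
  let ?U = "S - coloured h"
  have le: "selections h v + (if v \<in> S then 1 else 0) + multiplicity_in Ss v \<le> k" if "v \<in> V" for v
    using "2.prems"(5)[OF that] by (auto simp: multiplicity_in_def split: if_splits)
  show ?case
  proof (cases "?U = {}")
    case True
    have "selections h v + multiplicity_in Ss v \<le> k" if "v \<in> V" for v using le[OF that] by simp
    then show ?thesis using "2.IH"(1)[OF refl True] "2.prems" True by simp
  next
    case False
    let ?h = "h @ [(?U, \<sigma> h ?U)]"
    have "tokens k h v > 0" if "v \<in> ?U" for v
      using le[of v] that "2.prems"(4)[of S] by (auto simp: tokens_def)
    then have "painting_play V E k ?h" "follows_strategy \<sigma> ?h"
      using "2.prems"(1-3) "2.prems"(4)[of S] False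
      by (auto simp: painting_play_snoc follows_strategy_snoc painter_strategy_def)
    moreover have "selections ?h v + multiplicity_in Ss v \<le> k" if "v \<in> V" for v
      using le[OF that] by (auto split: if_splits)
    ultimately show ?thesis
      using "2.IH"(2)[OF refl False] "2.prems"(1,4) False by (simp add: Let_def)
  qed
qed simp

lemma not_paintable_by_reveal:
  assumes "length Sss = length ks"
    and "\<And>i v. i < length ks \<Longrightarrow> v \<in> V \<Longrightarrow> multiplicity_in (Sss ! i) v = ks ! i"
    and "\<And>S. S \<in> set (concat Sss) \<Longrightarrow> S \<subseteq> V"
    and "sum_list ks > 0"
    and escape: "\<And>\<sigma>. painter_strategy E \<sigma> \<Longrightarrow> \<not> V \<subseteq> coloured (reveal \<sigma> [] (concat Sss))"
  shows "\<not> painter_wins_block_game V E ks"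
proof
  assume "painter_wins_block_game V E ks"
  then obtain \<sigma> where \<sigma>: "painter_strategy E \<sigma>"
    and wins: "\<And>h. painting_play V E (sum_list ks) h \<Longrightarrow> respects_blocks V ks h \<Longrightarrow>
      follows_strategy \<sigma> h \<Longrightarrow> \<not> lister_wins V (sum_list ks) h"
    unfolding painter_wins_block_game_def by blast
  let ?h = "reveal \<sigma> [] (concat Sss)"
  have mult: "multiplicity_in (concat Sss) v = sum_list ks" if "v \<in> V" for v
  proof -
    have "map (\<lambda>Ss. multiplicity_in Ss v) Sss = ks"
      using assms(1,2) that by (intro nth_equalityI) auto
    moreover have "multiplicity_in (concat Sss) v = sum_list (map (\<lambda>Ss. multiplicity_in Ss v) Sss)"
      by (induction Sss) (auto simp: multiplicity_in_def)
    ultimately show ?thesis by simp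
  qed
  have "painting_play V E (sum_list ks) ([] @ ?h) \<and> follows_strategy \<sigma> ([] @ ?h)"
    using \<sigma> assms(3) mult
    by (intro reveal_play) (auto simp: painting_play_def follows_strategy_def)
  then have no: "\<not> lister_wins V (sum_list ks) ?h"
    using wins respects_blocks_reveal[OF assms(1,2)] by auto
  obtain v where v: "v \<in> V" "v \<notin> coloured ?h" using escape[OF \<sigma>] by blast
  then have "selections ?h v = sum_list ks" using selections_reveal_eq[of v "[]"] mult by simp
  \<comment> \<open>Only prefixes of positive length count in \<open>lister_wins\<close>, so the
    play must be nonempty.\<close>
  moreover from this have "?h \<noteq> []" using assms(4) by (metis less_irrefl selections_Nil)
  ultimately have "lister_wins V (sum_list ks) ?h"
    using v unfolding lister_wins_def
    by (intro bexI[of _ "length ?h"] bexI[of _ v]) (auto simp: tokens_def Suc_le_eq)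
  then show False using no by simp
qed

subsection \<open>The extremal graph\<close>

text \<open>The complete multipartite graph with \<open>m\<close> parts of size 3 and \<open>k - m\<close> parts of size 1. The part of
  \<open>v\<close> is \<open>v div 3\<close>; the vertex of a part of size 1 has residue 2 modulo 3.\<close>

definition mp_verts :: "nat \<Rightarrow> nat \<Rightarrow> nat set" where
  "mp_verts m k = {v. v div 3 < k \<and> (v div 3 < m \<or> v mod 3 = 2)}"

definition mp_edges :: "nat \<Rightarrow> nat \<Rightarrow> nat set set" where
  "mp_edges m k = {{u, v} | u v. u \<in> mp_verts m k \<and> v \<in> mp_verts m k \<and> u div 3 \<noteq> v div 3}"

lemma rep_in_mp_verts: "j < k \<Longrightarrow> 3 * j + 2 \<in> mp_verts m k"
proof -
  have "(3 * j + 2) mod 3 = 2" "(3 * j + 2) div 3 = j" by presburger+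
  then show "j < k \<Longrightarrow> 3 * j + 2 \<in> mp_verts m k" by (simp add: mp_verts_def)
qed

lemma mem_mp_edges:
  "{u, v} \<in> mp_edges m k \<longleftrightarrow> u \<in> mp_verts m k \<and> v \<in> mp_verts m k \<and> u div 3 \<noteq> v div 3"
  unfolding mp_edges_def by (auto simp: doubleton_eq_iff)

lemma finite_mp_verts [simp]: "finite (mp_verts m k)"
proof -
  have "mp_verts m k \<subseteq> {..<3 * k}" by (auto simp: mp_verts_def)
  then show ?thesis using finite_subset by blast
qed

lemma simple_graph_mp: "simple_graph (mp_verts m k) (mp_edges m k)"
  unfolding simple_graph_def mp_edges_def by (auto simp: card_insert_if)

lemma card_mp_verts:
  assumes "m \<le> k"
  shows "card (mp_verts m k) = 2 * m + k"
proof -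
  have eq: "mp_verts m k = {..<3 * m} \<union> (\<lambda>j. 3 * j + 2) ` {m..<k}"
  proof (intro equalityI subsetI)
    fix v assume v: "v \<in> mp_verts m k"
    show "v \<in> {..<3 * m} \<union> (\<lambda>j. 3 * j + 2) ` {m..<k}"
    proof (cases "v div 3 < m")
      case True
      then have "v < 3 * m" by linarith
      then show ?thesis by simp
    next
      case False
      then have "v = 3 * (v div 3) + 2" "v div 3 \<in> {m..<k}"
        using v by (auto simp: mp_verts_def) presburger
      then show ?thesis by blast
    qed
  next
    fix v assume "v \<in> {..<3 * m} \<union> (\<lambda>j. 3 * j + 2) ` {m..<k}"
    then show "v \<in> mp_verts m k"
    proof
      assume "v \<in> {..<3 * m}"
      then have "v div 3 < m" by auto
      then show ?thesis using assms by (simp add: mp_verts_def)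
    qed (use rep_in_mp_verts in auto)
  qed
  have "card ((\<lambda>j. 3 * j + 2) ` {m..<k}) = k - m"
    by (subst card_image) (auto simp: inj_on_def)
  then show ?thesis unfolding eq using assms by (subst card_Un_disjoint) auto
qed

text \<open>The parts are colour classes, and the vertices \<open>3 * j + 2\<close> with
  \<open>j < k\<close> form a clique.\<close>

lemma chromatic_number_mp: "chromatic_number (mp_verts m k) (mp_edges m k) = k"
  unfolding chromatic_number_def
proof (rule Least_equality)
  show "\<exists>c. proper_colouring (mp_verts m k) (mp_edges m k) k c"
    by (intro exI[of _ "\<lambda>v. v div 3"]) (auto simp: proper_colouring_def mem_mp_edges mp_verts_def)
next
  fix n assume "\<exists>c. proper_colouring (mp_verts m k) (mp_edges m k) n c"
  then obtain c where c: "proper_colouring (mp_verts m k) (mp_edges m k) n c" by blast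
  note rep = rep_in_mp_verts
  have "inj_on (\<lambda>j. c (3 * j + 2)) {..<k}"
  proof (rule inj_onI)
    fix i j assume ij: "i \<in> {..<k}" "j \<in> {..<k}" "c (3 * i + 2) = c (3 * j + 2)"
    then have "{3 * i + 2, 3 * j + 2} \<notin> mp_edges m k"
      using c rep unfolding proper_colouring_def by auto
    then show "i = j" using ij rep by (auto simp: mem_mp_edges)
  qed
  moreover have "(\<lambda>j. c (3 * j + 2)) ` {..<k} \<subseteq> {..<n}"
    using c rep by (auto simp: proper_colouring_def)
  ultimately show "k \<le> n" using card_inj_on_le[of "\<lambda>j. c (3 * j + 2)" "{..<k}" "{..<n}"] by simp
qed

section \<open>The potential of the uncoloured vertices\<close>

definition intact :: "nat \<Rightarrow> nat set \<Rightarrow> nat set" where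
  "intact m W = {j. j < m \<and> {3 * j, 3 * j + 1, 3 * j + 2} \<subseteq> W}"

text \<open>For the uncoloured set \<open>W\<close>, a part of size 3 is worth two units while
  untouched and one unit until it is used up; a part of size 1 is worth one.\<close>

definition potential :: "nat \<Rightarrow> nat set \<Rightarrow> nat" where
  "potential m W = card ((\<lambda>v. v div 3) ` W) + card (intact m W)"

lemma finite_intact [simp]: "finite (intact m W)"
  unfolding intact_def by simp

lemma potential_mp_verts:
  assumes "m \<le> k"
  shows "potential m (mp_verts m k) = k + m"
proof -
  have "(\<lambda>v. v div 3) ` mp_verts m k = {..<k}"
  proof (intro equalityI subsetI)
    fix j assume "j \<in> {..<k}"
    then have "3 * j + 2 \<in> mp_verts m k" "j = (3 * j + 2) div 3" using rep_in_mp_verts by auto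
    then show "j \<in> (\<lambda>v. v div 3) ` mp_verts m k" by blast
  qed (auto simp: mp_verts_def)
  moreover have "intact m (mp_verts m k) = {..<m}"
    using assms by (auto simp: intact_def mp_verts_def)
  ultimately show ?thesis by (simp add: potential_def)
qed

text \<open>A part of size 3 loses its two units of potential in different rounds if each round leaves out a
  residue class: after the first of them, the vertex of that class is still uncoloured.\<close>

lemma potential_Diff:
  assumes "finite W" "\<And>v. v \<in> I \<Longrightarrow> v div 3 = j"
  shows "potential m W \<le> potential m (W - I) + 2"
    and "t < 3 \<Longrightarrow> (\<And>v. v \<in> I \<Longrightarrow> v mod 3 \<noteq> t) \<Longrightarrow> potential m W \<le> potential m (W - I) + 1"
proof -
  let ?p = "\<lambda>W. (\<lambda>v. v div 3) ` W"
  \<comment> \<open>Only part \<open>j\<close> is touched, so each summand of the potential drops by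
    at most one.\<close>
  have p: "?p W \<subseteq> insert j (?p (W - I))" using assms(2) by auto
  have i: "intact m W \<subseteq> insert j (intact m (W - I))"
  proof
    fix l assume l: "l \<in> intact m W"
    show "l \<in> insert j (intact m (W - I))"
    proof (cases "l = j")
      case False
      then have "v \<notin> I" if "v div 3 = l" for v using assms(2) that by blast
      then have "3 * l \<notin> I" "3 * l + 1 \<notin> I" "3 * l + 2 \<notin> I" by simp_all
      then show ?thesis using l by (auto simp: intact_def)
    qed simp
  qed
  have le: "card X \<le> Suc (card Y)" if "X \<subseteq> insert j Y" "finite Y" for X Y
  proof -
    have "card X \<le> card (insert j Y)" using that by (intro card_mono) auto
    also have "\<dots> \<le> Suc (card Y)" using that(2) by (simp add: card_insert_if)
    finally show ?thesis .
  qed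
  have cp: "card (?p W) \<le> Suc (card (?p (W - I)))" using le[OF p] assms(1) by simp
  have ci: "card (intact m W) \<le> Suc (card (intact m (W - I)))" using le[OF i] by simp
  show "potential m W \<le> potential m (W - I) + 2"
    using cp ci by (simp add: potential_def)
  show "potential m W \<le> potential m (W - I) + 1" if t: "t < 3" "\<And>v. v \<in> I \<Longrightarrow> v mod 3 \<noteq> t"
  proof (cases "j \<in> intact m W")
    case True
    have "t = 0 \<or> t = 1 \<or> t = 2" using t(1) by auto
    then have "3 * j + t \<in> W" using True by (auto simp: intact_def)
    moreover have "3 * j + t \<notin> I" using t(2)[of "3 * j + t"] t(1) by auto
    moreover have "(3 * j + t) div 3 = j" using t(1) by simp
    ultimately have "j \<in> ?p (W - I)" by (metis DiffI image_eqI)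
    then have "?p W \<subseteq> ?p (W - I)" using p by blast
    then have "card (?p W) \<le> card (?p (W - I))" using assms(1) by (intro card_mono) auto
    then show ?thesis using ci by (simp add: potential_def)
  next
    case False
    then have "intact m W \<subseteq> intact m (W - I)" using i by blast
    then have "card (intact m W) \<le> card (intact m (W - I))" by (intro card_mono) auto
    then show ?thesis using cp by (simp add: potential_def)
  qed
qed

definition cost :: "nat set \<Rightarrow> nat" where
  "cost S = (if \<exists>t<3. \<forall>v\<in>S. v mod 3 \<noteq> t then 1 else 2)"

lemma potential_independent:
  assumes "finite W" "independent_set (mp_edges m k) I" "I \<subseteq> S" "S \<subseteq> mp_verts m k"
  shows "potential m W \<le> potential m (W - I) + cost S"
proof -
  \<comment> \<open>An independent set of a complete multipartite graph lies in one part; for the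
    empty set any \<open>j\<close> serves.\<close>
  obtain j where j: "\<And>v. v \<in> I \<Longrightarrow> v div 3 = j"
  proof (cases "I = {}")
    case False
    then obtain u where u: "u \<in> I" by blast
    show ?thesis
    proof (rule that[of "u div 3"])
      fix v assume "v \<in> I"
      then have "{u, v} \<notin> mp_edges m k" using assms(2) u by (simp add: independent_set_def)
      then show "v div 3 = u div 3" using u \<open>v \<in> I\<close> assms(3,4) by (auto simp: mem_mp_edges)
    qed
  qed (use that in blast)
  show ?thesis
  proof (cases "\<exists>t<3. \<forall>v\<in>S. v mod 3 \<noteq> t")
    case True
    then obtain t where "t < 3" "\<And>v. v \<in> I \<Longrightarrow> v mod 3 \<noteq> t" using assms(3) by blast
    then have "potential m W \<le> potential m (W - I) + 1" using potential_Diff(2)[OF assms(1) j] by blast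
    then show ?thesis using True by (simp add: cost_def)
  next
    case False
    then have "cost S = 2" unfolding cost_def by (simp only: if_False)
    then show ?thesis using potential_Diff(1)[OF assms(1) j] by metis
  qed
qed

text \<open>The losses of the single rounds add up. Each cost is taken of the planned set, which
  contains what is really selected, and a skipped round loses nothing.\<close>

lemma potential_reveal:
  assumes "painter_strategy (mp_edges m k) \<sigma>" "\<And>S. S \<in> set Ss \<Longrightarrow> S \<subseteq> mp_verts m k"
  shows "potential m (mp_verts m k - coloured h)
    \<le> potential m (mp_verts m k - coloured (h @ reveal \<sigma> h Ss)) + sum_list (map cost Ss)"
  using assms
proof (induction \<sigma> h Ss rule: reveal.induct)
  case (2 \<sigma> h S Ss)
  let ?U = "S - coloured h"
  show ?case
  proof (cases "?U = {}")
    case True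
    then show ?thesis using "2.IH"(1)[OF refl True] "2.prems" by simp
  next
    case False
    let ?I = "\<sigma> h ?U"
    have "potential m (mp_verts m k - coloured h)
      \<le> potential m (mp_verts m k - coloured h - ?I) + cost S"
    proof (rule potential_independent)
      show "independent_set (mp_edges m k) ?I" "?I \<subseteq> S" "S \<subseteq> mp_verts m k"
        using "2.prems" by (auto simp: painter_strategy_def)
    qed simp
    moreover have "mp_verts m k - coloured h - ?I = mp_verts m k - coloured (h @ [(?U, ?I)])" by auto
    ultimately show ?thesis
      using "2.IH"(2)[OF refl False] "2.prems" False by (simp add: Let_def Un_assoc)
  qed
qed simp

section \<open>Lister's plan on the extremal graph\<close>

definition lister_block :: "'a set \<Rightarrow> ('a \<Rightarrow> nat) \<Rightarrow> nat \<Rightarrow> 'a set list" where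
  "lister_block V f k = (if k = 1 then [V] else map (\<lambda>t. {v \<in> V. f v \<noteq> t}) [0, 1, 2])"

text \<open>Of the three rounds of a block 2, exactly the one with \<open>t = f v\<close> omits
  \<open>v\<close>.\<close>

lemma multiplicity_lister_block:
  assumes "v \<in> V" "f v < 3" "k \<in> {1, 2}"
  shows "multiplicity_in (lister_block V f k) v = k"
proof -
  have "f v = 0 \<or> f v = 1 \<or> f v = 2" using assms(2) by auto
  then show ?thesis using assms by (auto simp: lister_block_def multiplicity_in_def)
qed

lemma cost_lister_blocks:
  "set ks \<subseteq> {1, 2} \<Longrightarrow>
    sum_list (map cost (concat (map (lister_block V (\<lambda>v. v mod 3)) ks)))
      \<le> 2 * count_list ks 1 + 3 * count_list ks 2"
proof (induction ks)
  case (Cons k ks)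
  have "cost V \<le> 2" by (simp add: cost_def)
  moreover have c: "cost {v \<in> V. v mod 3 \<noteq> t} = 1" if "t < 3" for t
    using that by (auto simp: cost_def)
  ultimately have "sum_list (map cost (lister_block V (\<lambda>v. v mod 3) k)) \<le> (if k = 1 then 2 else 3)"
    using c[of 0] c[of 1] c[of 2] by (simp add: lister_block_def)
  then show ?case using Cons by auto
qed simp

lemma mp_not_paintable:
  assumes "set_mset L \<subseteq> {1, 2}" "count L 2 \<ge> 1"
    and m: "m = count L 1 + count L 2 + 1" and k: "k = count L 1 + 2 * count L 2"
  shows "\<not> paintable (mp_verts m k) (mp_edges m k) L"
proof -
  obtain ks where ks: "mset ks = L" by (metis ex_mset)
  have set: "set ks \<subseteq> {1, 2}" using assms(1) ks by auto
  have c: "count_list ks x = count L x" for x using ks by (metis count_mset)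
  let ?V = "mp_verts m k" and ?Sss = "map (lister_block (mp_verts m k) (\<lambda>v. v mod 3)) ks"
  have "\<not> painter_wins_block_game ?V (mp_edges m k) ks"
  proof (rule not_paintable_by_reveal)
    show "length ?Sss = length ks" by simp
    show "multiplicity_in (?Sss ! i) v = ks ! i" if "i < length ks" "v \<in> ?V" for i v
    proof -
      have "ks ! i \<in> {1, 2}" using set nth_mem[OF that(1)] by blast
      then show ?thesis using multiplicity_lister_block[OF that(2)] that(1) by simp
    qed
    show sub: "S \<subseteq> ?V" if "S \<in> set (concat ?Sss)" for S
      using that by (auto simp: lister_block_def split: if_splits)
    show "sum_list ks > 0" using sum_list_ones_twos[OF set] c assms(2) by simp
    fix \<sigma> assume \<sigma>: "painter_strategy (mp_edges m k) \<sigma>"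
    show "\<not> ?V \<subseteq> coloured (reveal \<sigma> [] (concat ?Sss))"
    proof
      assume "?V \<subseteq> coloured (reveal \<sigma> [] (concat ?Sss))"
      then have all: "?V - coloured ([] @ reveal \<sigma> [] (concat ?Sss)) = {}" by simp
      have none: "potential m {} = 0" by (simp add: potential_def intact_def)
      have "potential m (?V - coloured [])
        \<le> potential m (?V - coloured ([] @ reveal \<sigma> [] (concat ?Sss))) + sum_list (map cost (concat ?Sss))"
        by (rule potential_reveal[OF \<sigma>]) (rule sub)
      then have "potential m (?V - coloured []) \<le> sum_list (map cost (concat ?Sss))"
        by (simp only: all none add_0)
      \<comment> \<open>The left side equals \<open>2 * count L 1 + 3 * count L 2 + 1\<close>; a
        block of value 2 is needed for \<open>m \<le> k\<close>.\<close>
      then have "k + m \<le> 2 * count L 1 + 3 * count L 2"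
        using cost_lister_blocks[OF set, of ?V] potential_mp_verts[of m k] m k assms(2) c by simp
      then show False using m k by simp
    qed
  qed
  then show ?thesis using ks unfolding paintable_def by blast
qed

theorem theorem4:
  fixes L :: "nat multiset"
  assumes "\<forall>k \<in># L. 0 < k"
    and "size L < sum_mset L"
    and "\<forall>k \<in># L. k \<le> 2"
  shows "psi L = enat (2 * sum_mset L + count L 1 + 2)"
proof -
  have sub: "set_mset L \<subseteq> {1, 2}" using assms(1,3) by force
  have "set_mset N \<subseteq> {1, 2} \<Longrightarrow> sum_mset N = count N 1 + 2 * count N 2 \<and> size N = count N 1 + count N 2"
    for N :: "nat multiset"
    by (induction N) auto
  then have k: "sum_mset L = count L 1 + 2 * count L 2" and "size L = count L 1 + count L 2"
    using sub by auto
  then have two: "count L 2 \<ge> 1" using assms(2) by linarith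
  let ?m = "count L 1 + count L 2 + 1" and ?k = "sum_mset L"
  have "psi L \<le> enat (card (mp_verts ?m ?k))"
    unfolding psi_def
  proof (rule Inf_lower, intro CollectI exI conjI)
    show "simple_graph (mp_verts ?m ?k) (mp_edges ?m ?k)" by (rule simple_graph_mp)
    show "chromatic_number (mp_verts ?m ?k) (mp_edges ?m ?k) = sum_mset L"
      by (rule chromatic_number_mp)
    show "\<not> paintable (mp_verts ?m ?k) (mp_edges ?m ?k) L"
      using sub two refl k by (rule mp_not_paintable)
  qed (rule refl)
  \<comment> \<open>With \<open>a\<close> ones and \<open>b\<close> twos this is
    \<open>2 * (a + b + 1) + (a + 2 * b) = 3 * a + 4 * b + 2\<close>.\<close>
  also have "card (mp_verts ?m ?k) = 2 * sum_mset L + count L 1 + 2"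
    using card_mp_verts[of ?m ?k] k two by simp
  finally have "psi L \<le> enat (2 * sum_mset L + count L 1 + 2)" .
  moreover have "enat (2 * sum_mset L + count L 1 + 2) \<le> psi L"
    unfolding psi_def
  proof (rule Inf_greatest, clarify)
    fix V :: "nat set" and E
    assume "simple_graph V E" "chromatic_number V E = sum_mset L" "\<not> paintable V E L"
    then have "\<not> card V \<le> 2 * sum_mset L + count L 1 + 1" using paintable_of_small sub by blast
    then show "enat (2 * sum_mset L + count L 1 + 2) \<le> enat (card V)" by simp
  qed
  ultimately show ?thesis by (rule antisym)
qed

end
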